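(* Let $\beta\ge2$ and $\lambda>0$, and let $$p_{\beta,\lambda}(x)=\frac{\beta\lambda^{1/\beta}}{2\Gamma(1/\beta)}e^{-\lambda|x|^\beta},\qquad F(x)=\int_{-\infty}^xp_{\beta,\lambda}(t)\,dt,\qquad x\in\mathbb R .$$ For $z\in\mathbb R$ let $$f_z(x)=\begin{cases}\dfrac{F(x)(1-F(z))}{p_{\beta,\lambda}(x)},&x\le z,\\[2mm]\dfrac{F(z)(1-F(x))}{p_{\beta,\lambda}(x)},&x>z.\end{cases}$$ Then $$\sup_{z\in\mathbb R}\|f_z\|_\infty=\frac{\Gamma(1/\beta)}{2\beta\lambda^{1/\beta}},\qquad \sup_{z\in\mathbb R}\|f_z'\|_\infty=1,\qquad \sup_{z\in\mathbb R}\,\sup_{x\in\mathbb R}\bigl|\beta\lambda\,\operatorname{sgn}(x)|x|^{\beta-1}f_z(x)\bigr|=1 .$$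
   Context: $\|\cdot\|_\infty$ denotes the supremum norm over $x\in\mathbb R$. The function $f_z$ is the bounded solution of the Stein equation $f_z'(x)-\beta\lambda\,\operatorname{sgn}(x)|x|^{\beta-1}f_z(x)=\mathbf 1_{(-\infty,z]}(x)-F(z)$; its derivative $f_z'$ is understood on $\mathbb R\setminus\{z\}$ and $\|f_z'\|_\infty$ is the essential supremum of $|f_z'|$, equivalently its supremum over $\mathbb R\setminus\{z\}$. *)

theory Defs
  imports "HOL-Analysis.Analysis" "HOL-Probability.Essential_Supremum"
begin

definition gg_density :: "real \<Rightarrow> real \<Rightarrow> real \<Rightarrow> real" where
  "gg_density \<beta> lam x =
     \<beta> * lam powr (1 / \<beta>) / (2 * Gamma (1 / \<beta>)) * exp (- lam * \<bar>x\<bar> powr \<beta>)"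

definition gg_cdf :: "real \<Rightarrow> real \<Rightarrow> real \<Rightarrow> real" where
  "gg_cdf \<beta> lam x = (LBINT t:{..x}. gg_density \<beta> lam t)"

definition stein_sol :: "real \<Rightarrow> real \<Rightarrow> real \<Rightarrow> real \<Rightarrow> real" where
  "stein_sol \<beta> lam z x =
     (if x \<le> z then gg_cdf \<beta> lam x * (1 - gg_cdf \<beta> lam z) / gg_density \<beta> lam x
      else gg_cdf \<beta> lam z * (1 - gg_cdf \<beta> lam x) / gg_density \<beta> lam x)"

text \<open>Suprema and norms are valued in the extended reals, so that an equation with a finite
  right-hand side also asserts boundedness (\<^term>\<open>Sup\<close> of an unbounded set of reals is unspecified).\<close>

definition sup_norm :: "(real \<Rightarrow> real) \<Rightarrow> ereal" where
  "sup_norm g = (SUP x. ereal \<bar>g x\<bar>)"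

definition ess_sup_norm :: "(real \<Rightarrow> real) \<Rightarrow> ereal" where
  "ess_sup_norm g = esssup lborel (\<lambda>x. ereal \<bar>g x\<bar>)"

lemma abs_powr_has_real_derivative:
  fixes \<beta> x :: real
  assumes "1 < \<beta>"
  shows "((\<lambda>x. \<bar>x\<bar> powr \<beta>) has_real_derivative \<beta> * sgn x * \<bar>x\<bar> powr (\<beta> - 1)) (at x)"
proof (cases "x = 0")
  case True
  have "((\<lambda>h::real. \<bar>h\<bar> powr (\<beta> - 1)) \<longlongrightarrow> \<bar>0\<bar> powr (\<beta> - 1)) (at 0)"
    by (rule tendsto_powr') (use assms in \<open>auto intro!: tendsto_eq_intros\<close>)
  then have "((\<lambda>h::real. \<bar>h\<bar> powr (\<beta> - 1)) \<longlongrightarrow> 0) (at 0)"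
    by simp
  moreover have "\<bar>\<bar>h\<bar> powr \<beta> / h\<bar> = \<bar>h\<bar> powr (\<beta> - 1)" if "h \<noteq> 0" for h :: real
    using that by (simp add: powr_diff abs_mult)
  ultimately have "((\<lambda>h::real. \<bar>\<bar>h\<bar> powr \<beta> / h\<bar>) \<longlongrightarrow> 0) (at 0)"
    by (subst tendsto_cong[where g = "\<lambda>h. \<bar>h\<bar> powr (\<beta> - 1)"])
       (auto simp: eventually_at_filter)
  then have "((\<lambda>h::real. \<bar>h\<bar> powr \<beta> / h) \<longlongrightarrow> 0) (at 0)"
    by (rule tendsto_rabs_zero_cancel)
  then show ?thesis
    using True by (simp add: DERIV_def)
next
  case False
  have "(abs has_real_derivative sgn x) (at x)"
  proof (cases "0 < x")
    case True
    show ?thesis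
      by (rule has_field_derivative_transform_within_open[OF DERIV_ident[THEN DERIV_cong], where S = "{0<..}"])
         (use True in auto)
  next
    case neg: False
    show ?thesis
      by (rule has_field_derivative_transform_within_open[OF DERIV_minus[OF DERIV_ident, THEN DERIV_cong], where S = "{..<0}"])
         (use neg False in auto)
  qed
  then have "((\<lambda>x. \<bar>x\<bar> powr \<beta>) has_real_derivative \<bar>x\<bar> powr \<beta> * (0 * ln \<bar>x\<bar> + sgn x * \<beta> / \<bar>x\<bar>)) (at x)"
    by (rule DERIV_powr) (use False in auto)
  then show ?thesis
    using False by (simp add: powr_diff mult_ac)
qed

lemma gg_density_pos:
  assumes "1 < \<beta>" "0 < lam"
  shows "0 < gg_density \<beta> lam x"
  unfolding gg_density_def using assms by (simp add: Gamma_real_pos)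

lemma gg_density_has_real_derivative:
  assumes "1 < \<beta>"
  shows "(gg_density \<beta> lam has_real_derivative
           - (\<beta> * lam * sgn x * \<bar>x\<bar> powr (\<beta> - 1)) * gg_density \<beta> lam x) (at x)"
proof -
  have "((\<lambda>x. - lam * \<bar>x\<bar> powr \<beta>) has_real_derivative
      - lam * (\<beta> * sgn x * \<bar>x\<bar> powr (\<beta> - 1))) (at x)"
    by (rule DERIV_cmult[OF abs_powr_has_real_derivative[OF assms]])
  from DERIV_cmult[OF DERIV_fun_exp[OF this], of "\<beta> * lam powr (1 / \<beta>) / (2 * Gamma (1 / \<beta>))"]
  show ?thesis
    unfolding gg_density_def by (simp add: mult_ac)
qed

lemma integrable_gg_density:
  assumes "1 < \<beta>" "0 < lam"
  shows "integrable lborel (gg_density \<beta> lam)"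
proof -
  have meas: "(\<lambda>x::real. exp (- lam * \<bar>x\<bar>)) \<in> borel_measurable borel"
    by measurable
  have half: "set_integrable lborel {0..} (\<lambda>x::real. exp (- lam * x))"
  proof -
    have "(\<lambda>x::real. exp (- lam * x)) absolutely_integrable_on {0..}"
      by (rule nonnegative_absolutely_integrable_1)
         (use assms integrable_on_exp_minus_to_infinity[of lam 0] in auto)
    then show ?thesis
      unfolding set_integrable_def
      by (subst (asm) integrable_completion) auto
  qed
  then have pos: "integrable lborel (\<lambda>x. indicator {0..} x *\<^sub>R exp (- lam * x))"
    by (simp add: set_integrable_def)
  from lborel_integrable_real_affine[OF pos, of "-1" 0]
  have neg: "integrable lborel (\<lambda>x. indicator {0..} (- x) *\<^sub>R exp (lam * x))"
    by simp
  have "integrable lborel (\<lambda>x::real. exp (- lam * \<bar>x\<bar>))"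
    by (rule Bochner_Integration.integrable_bound[OF Bochner_Integration.integrable_add[OF pos neg]])
       (auto simp: indicator_def)
  then have "integrable lborel
      (\<lambda>x::real. \<beta> * lam powr (1 / \<beta>) / (2 * Gamma (1 / \<beta>)) * exp lam * exp (- lam * \<bar>x\<bar>))"
    by simp
  then show ?thesis
  proof (rule Bochner_Integration.integrable_bound)
    show "gg_density \<beta> lam \<in> borel_measurable lborel"
      unfolding gg_density_def by measurable
    have "\<bar>x\<bar> \<le> 1 + \<bar>x\<bar> powr \<beta>" for x :: real
    proof (cases "\<bar>x\<bar> \<le> 1")
      case False
      then have "\<bar>x\<bar> powr 1 \<le> \<bar>x\<bar> powr \<beta>"
        using assms by (intro powr_mono) auto
      then show ?thesis using False by simp
    qed (use powr_ge_zero[of "\<bar>x\<bar>" \<beta>] in linarith)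
    then have "lam * \<bar>x\<bar> \<le> lam * (1 + \<bar>x\<bar> powr \<beta>)" for x :: real
      using assms by (intro mult_left_mono) auto
    then have "exp (- lam * \<bar>x\<bar> powr \<beta>) \<le> exp lam * exp (- lam * \<bar>x\<bar>)" for x :: real
      by (simp add: exp_add[symmetric] algebra_simps)
    then show "AE x in lborel. norm (gg_density \<beta> lam x) \<le>
        norm (\<beta> * lam powr (1 / \<beta>) / (2 * Gamma (1 / \<beta>)) * exp lam * exp (- lam * \<bar>x\<bar>))"
      using assms Gamma_real_pos[of "1 / \<beta>"]
      by (auto simp: gg_density_def abs_mult mult_left_mono divide_right_mono)
  qed
qed

lemma gg_cdf_has_real_derivative:
  assumes "1 < \<beta>" "0 < lam"
  shows "(gg_cdf \<beta> lam has_real_derivative gg_density \<beta> lam x) (at x)"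
proof -
  let ?p = "gg_density \<beta> lam"
  have int: "set_integrable lborel A ?p" if "A \<in> sets borel" for A
    using integrable_gg_density[OF assms] that
    unfolding set_integrable_def by (intro integrable_mult_indicator) auto
  have cont: "continuous_on A ?p" for A
    using gg_density_has_real_derivative[OF assms(1)]
    by (meson DERIV_isCont continuous_at_imp_continuous_on)
  have eq: "gg_cdf \<beta> lam y = gg_cdf \<beta> lam (x - 1) + integral {x - 1..y} ?p" if "x - 1 < y" for y
  proof -
    have "gg_cdf \<beta> lam y = (LBINT t:{..x - 1} \<union> {x - 1<..y}. ?p t)"
      unfolding gg_cdf_def using that by (simp add: ivl_disj_un)
    also have "\<dots> = gg_cdf \<beta> lam (x - 1) + (LBINT t:{x - 1<..y}. ?p t)"
      unfolding gg_cdf_def by (rule set_integral_Un) (auto intro: int)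
    also have "(LBINT t:{x - 1<..y}. ?p t) = (LBINT t:{x - 1..y}. ?p t)"
    proof (rule set_integral_cong_set)
      show "AE t in lborel. (t \<in> {x - 1..y}) = (t \<in> {x - 1<..y})"
        using AE_lborel_singleton[of "x - 1"] by eventually_elim auto
    qed (auto simp: set_borel_measurable_def gg_density_def)
    also have "\<dots> = integral {x - 1..y} ?p"
      by (rule set_borel_integral_eq_integral) (auto intro: int)
    finally show ?thesis .
  qed
  have "((\<lambda>y. integral {x - 1..y} ?p) has_real_derivative ?p x) (at x within {x - 1..x + 1})"
    by (rule integral_has_real_derivative) (auto intro: cont)
  then have "((\<lambda>y. integral {x - 1..y} ?p) has_real_derivative ?p x) (at x)"
    by (subst (asm) at_within_interior) auto
  then have *: "((\<lambda>y. gg_cdf \<beta> lam (x - 1) + integral {x - 1..y} ?p) has_real_derivative ?p x) (at x)"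
    by (auto intro!: derivative_eq_intros)
  show ?thesis
    by (rule has_field_derivative_transform_within_open[OF *, of "{x - 1<..}"]) (auto simp: eq)
qed

text \<open>Away from \<^term>\<open>z\<close> the function \<^term>\<open>stein_sol \<beta> lam z\<close> is differentiable and solves the
  Stein equation. Hence \<^term>\<open>deriv\<close> is meaningful off the null set \<^term>\<open>{z}\<close>, and its value
  at \<^term>\<open>z\<close> does not affect the essential supremum.\<close>

lemma stein_sol_has_real_derivative:
  assumes "1 < \<beta>" "0 < lam" "x \<noteq> z"
  shows "(stein_sol \<beta> lam z has_real_derivative
           \<beta> * lam * sgn x * \<bar>x\<bar> powr (\<beta> - 1) * stein_sol \<beta> lam z x
             + (indicator {..z} x - gg_cdf \<beta> lam z)) (at x)"
proof -
  let ?p = "gg_density \<beta> lam" and ?F = "gg_cdf \<beta> lam"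
  note [derivative_intros] = gg_density_has_real_derivative[THEN DERIV_chain2, OF assms(1)]
    gg_cdf_has_real_derivative[THEN DERIV_chain2, OF assms(1,2)]
  have p: "?p x \<noteq> 0"
    using gg_density_pos[OF assms(1,2), of x] by simp
  consider "x < z" | "z < x"
    using assms(3) by linarith
  then show ?thesis
  proof cases
    case 1
    have *: "((\<lambda>y. ?F y * (1 - ?F z) / ?p y) has_real_derivative
        \<beta> * lam * sgn x * \<bar>x\<bar> powr (\<beta> - 1) * (?F x * (1 - ?F z) / ?p x) + (1 - ?F z)) (at x)"
      using p by (auto intro!: derivative_eq_intros simp: field_simps)
    have "(stein_sol \<beta> lam z has_real_derivative
        \<beta> * lam * sgn x * \<bar>x\<bar> powr (\<beta> - 1) * (?F x * (1 - ?F z) / ?p x) + (1 - ?F z)) (at x)"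
      by (rule has_field_derivative_transform_within_open[OF *, of "{..<z}"])
         (use 1 in \<open>auto simp: stein_sol_def\<close>)
    then show ?thesis
      using 1 by (simp add: stein_sol_def)
  next
    case 2
    have *: "((\<lambda>y. ?F z * (1 - ?F y) / ?p y) has_real_derivative
        \<beta> * lam * sgn x * \<bar>x\<bar> powr (\<beta> - 1) * (?F z * (1 - ?F x) / ?p x) + (- ?F z)) (at x)"
      using p by (auto intro!: derivative_eq_intros simp: field_simps)
    have "(stein_sol \<beta> lam z has_real_derivative
        \<beta> * lam * sgn x * \<bar>x\<bar> powr (\<beta> - 1) * (?F z * (1 - ?F x) / ?p x) + (- ?F z)) (at x)"
      by (rule has_field_derivative_transform_within_open[OF *, of "{z<..}"])
         (use 2 in \<open>auto simp: stein_sol_def\<close>)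
    then show ?thesis
      using 2 by (simp add: stein_sol_def)
  qed
qed

end

theory Submission
  imports Defs "HOL-Real_Asymp.Real_Asymp"
begin

text \<open>Write \<open>\<psi> = - p' / p\<close>. The tail satisfies the Mills bound \<open>\<psi> (1 - F) \<le> p\<close> on \<open>[0, \<infinity>)\<close>, and
  \<open>\<psi> (1 - F) / p \<rightarrow> 1\<close> at infinity. With the symmetry \<open>f\<^sub>-\<^sub>z(-x) = f\<^sub>z(x)\<close>, the bound gives
  \<open>\<bar>\<psi> f\<^sub>z\<bar> \<le> 1\<close> and \<open>\<bar>f\<^sub>z'\<bar> \<le> 1\<close>; both are sharp as \<open>z \<rightarrow> \<infinity>\<close>, near \<open>x = z\<close> from the left.
  It also makes \<open>F / p\<close> increasing, so \<open>f\<^sub>z\<close> is maximal at \<open>z\<close>, and the first supremum reduces to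
  \<open>4 p(0) F (1 - F) \<le> p\<close>, which is where \<open>\<beta> \<ge> 2\<close> enters.\<close>

section \<open>Comparison with infinity and lower bounds for essential suprema\<close>

text \<open>A nonincreasing function lies above its limit. Both Mills bounds and the final density
  inequality compare a point with infinity in this way.\<close>

lemma nonneg_if_deriv_nonpos_tendsto_0:
  fixes g g' :: "real \<Rightarrow> real"
  assumes deriv: "\<And>x. a \<le> x \<Longrightarrow> (g has_real_derivative g' x) (at x)"
    and nonpos: "\<And>x. a \<le> x \<Longrightarrow> g' x \<le> 0"
    and lim: "(g \<longlongrightarrow> 0) at_top"
  shows "0 \<le> g a"
proof (rule tendsto_upperbound[OF lim])
  show "\<forall>\<^sub>F x in at_top. g x \<le> g a"
    using eventually_ge_at_top[of a]
  proof eventually_elim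
    case (elim x)
    show ?case
      by (rule DERIV_nonpos_imp_nonincreasing[OF elim]) (use deriv nonpos in blast)
  qed
qed simp

text \<open>An interval \<open>{b<..<z}\<close> with \<open>b < z\<close> has positive Lebesgue
  measure, so it cannot lie in the exceptional null set.\<close>

lemma AE_lborel_imp_frequently_at_left:
  fixes z :: real
  assumes "AE x in lborel. P x"
  shows "\<exists>\<^sub>F x in at_left z. P x"
  unfolding frequently_def
proof
  assume "\<forall>\<^sub>F x in at_left z. \<not> P x"
  then obtain b where b: "b < z" "\<And>x. b < x \<Longrightarrow> x < z \<Longrightarrow> \<not> P x"
    using eventually_at_left[of "z - 1" z] by auto
  have "AE x in lborel. x \<notin> {b<..<z}"
    using assms by eventually_elim (use b in auto)
  then have "{b<..<z} \<in> null_sets lborel"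
    by (subst AE_iff_null_sets) auto
  then show False
    using b(1) by (simp add: null_sets_def)
qed

text \<open>Values close to the one-sided limit fill an interval of positive measure. The value of
  \<open>g\<close> at \<open>z\<close> never enters, which suits the derivative of a function with a
  kink at \<open>z\<close>.\<close>

lemma abs_le_ess_sup_norm_at_left:
  assumes "(g \<longlongrightarrow> L) (at_left z)"
  shows "ereal \<bar>L\<bar> \<le> ess_sup_norm g"
proof (rule ccontr)
  assume "\<not> ereal \<bar>L\<bar> \<le> ess_sup_norm g"
  then have less: "ess_sup_norm g < ereal \<bar>L\<bar>" by simp
  have "((\<lambda>x. ereal \<bar>g x\<bar>) \<longlongrightarrow> ereal \<bar>L\<bar>) (at_left z)"
    by (intro tendsto_intros assms)
  then have "\<forall>\<^sub>F x in at_left z. ess_sup_norm g < ereal \<bar>g x\<bar>"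
    by (rule order_tendstoD) (rule less)
  moreover have "\<exists>\<^sub>F x in at_left z. ereal \<bar>g x\<bar> \<le> ess_sup_norm g"
    unfolding ess_sup_norm_def by (rule AE_lborel_imp_frequently_at_left[OF esssup_AE])
  ultimately show False
    unfolding frequently_def by (simp add: not_le)
qed

section \<open>Symmetry and normalisation of the density\<close>

definition gg_score :: "real \<Rightarrow> real \<Rightarrow> real \<Rightarrow> real" where
  "gg_score \<beta> lam x = \<beta> * lam * sgn x * \<bar>x\<bar> powr (\<beta> - 1)"

lemma gg_score_minus: "gg_score \<beta> lam (- x) = - gg_score \<beta> lam x"
  by (simp add: gg_score_def sgn_minus)

lemma gg_score_0 [simp]: "gg_score \<beta> lam 0 = 0"
  by (simp add: gg_score_def)

lemma gg_density_minus: "gg_density \<beta> lam (- x) = gg_density \<beta> lam x"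
  by (simp add: gg_density_def)

text \<open>Substitute \<open>t = lam * x powr \<beta>\<close> in the Gamma integral at
  \<open>1 / \<beta>\<close>. This explains the normalising constant of the density.\<close>

lemma has_integral_exp_minus_powr:
  fixes \<beta> lam :: real
  assumes "0 < \<beta>" "0 < lam"
  shows "((\<lambda>x. \<beta> * lam powr (1 / \<beta>) * exp (- lam * x powr \<beta>)) has_integral Gamma (1 / \<beta>)) {0<..}"
proof -
  let ?f = "\<lambda>t::real. t powr (1 / \<beta> - 1) / exp t"
  let ?g = "\<lambda>x::real. lam * x powr \<beta>"
  let ?g' = "\<lambda>x::real. lam * (\<beta> * x powr (\<beta> - 1))"
  \<comment> \<open>Since \<open>0 powr a = 0\<close>, the integrand vanishes at the endpoint
    \<open>0\<close>, so the open and the closed half-line give the same integral.\<close>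
  have null: "{x \<in> {0..} - {0<..}. ?f x \<noteq> 0} = {}" "{x \<in> {0<..} - {0..}. ?f x \<noteq> 0} = {}"
    by auto
  have "(?f has_integral Gamma (1 / \<beta>)) {0..}"
    by (rule Gamma_integral_real) (use assms in auto)
  then have gam: "(?f has_integral Gamma (1 / \<beta>)) {0<..}"
    using has_integral_spike_set_eq[of "{0..}" "{0<..}" ?f] unfolding null by simp
  have img: "?g ` {0<..} = {0<..}"
  proof safe
    fix y :: real assume "0 < y"
    then have "y = ?g ((y / lam) powr (1 / \<beta>))" "0 < (y / lam) powr (1 / \<beta>)"
      using assms by (auto simp: powr_powr)
    then show "y \<in> ?g ` {0<..}" by blast
  qed (use assms in auto)
  have "(\<lambda>x. \<bar>?g' x\<bar> * ?f (?g x)) absolutely_integrable_on {0<..} \<and>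
      integral {0<..} (\<lambda>x. \<bar>?g' x\<bar> * ?f (?g x)) = Gamma (1 / \<beta>)"
  proof (rule has_absolute_integral_change_of_variables_1'[where g = ?g and g' = ?g' and f = ?f, THEN iffD2])
    show "(?g has_field_derivative ?g' x) (at x within {0<..})" if "x \<in> {0<..}" for x
      using that by (auto intro!: derivative_eq_intros)
    show "inj_on ?g {0<..}"
      by (rule inj_on_inverseI[where g = "\<lambda>y. (y / lam) powr (1 / \<beta>)"])
         (use assms in \<open>auto simp: powr_powr\<close>)
    have "?f absolutely_integrable_on {0<..}"
      by (rule nonnegative_absolutely_integrable_1) (use gam in auto)
    then show "?f absolutely_integrable_on ?g ` {0<..} \<and> integral (?g ` {0<..}) ?f = Gamma (1 / \<beta>)"
      using gam by (simp add: img integral_unique)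
  qed simp
  then have "((\<lambda>x. \<bar>?g' x\<bar> * ?f (?g x)) has_integral Gamma (1 / \<beta>)) {0<..}"
    using set_lebesgue_integral_eq_integral(1) unfolding has_integral_integrable_integral by blast
  then show ?thesis
  proof (rule has_integral_eq[rotated])
    fix x :: real assume x: "x \<in> {0<..}"
    \<comment> \<open>The power of \<open>x\<close> produced here cancels the factor
      \<open>x powr (\<beta> - 1)\<close> of the Jacobian, so only a constant is left in front of
      the exponential.\<close>
    have "(lam * x powr \<beta>) powr (1 / \<beta> - 1) = lam powr (1 / \<beta> - 1) * x powr (1 - \<beta>)"
      using assms x by (simp add: powr_mult powr_powr right_diff_distrib)
    then have "\<bar>?g' x\<bar> * (lam * x powr \<beta>) powr (1 / \<beta> - 1)
        = \<beta> * (lam * lam powr (1 / \<beta> - 1)) * (x powr (\<beta> - 1) * x powr (1 - \<beta>))"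
      using assms x by simp
    also have "\<dots> = \<beta> * lam powr (1 / \<beta>)"
      using assms x by (simp add: powr_add[symmetric] powr_mult_base)
    finally show "\<bar>?g' x\<bar> * ?f (?g x) = \<beta> * lam powr (1 / \<beta>) * exp (- lam * x powr \<beta>)"
      by (simp add: exp_minus field_simps)
  qed
qed

context
  fixes \<beta> lam :: real
  assumes \<beta>: "1 < \<beta>" and lam: "0 < lam"
begin

abbreviation (input) "p \<equiv> gg_density \<beta> lam"
abbreviation (input) "F \<equiv> gg_cdf \<beta> lam"
abbreviation (input) "\<psi> \<equiv> gg_score \<beta> lam"

lemma borel_measurable_gg_density [measurable]: "p \<in> borel_measurable borel"
  unfolding gg_density_def by measurable

text \<open>Each half-line carries mass \<open>1 / 2\<close>: the right one by the Gamma integral,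
  the left one by reflection.\<close>

lemma gg_density_total: "integral\<^sup>L lborel p = 1"
proof -
  have int: "integrable lborel p"
    by (rule integrable_gg_density[OF \<beta> lam])
  have G: "Gamma (1 / \<beta>) \<noteq> 0"
    using Gamma_real_pos[of "1 / \<beta>"] \<beta> by fastforce
  have "((\<lambda>x. 1 / (2 * Gamma (1 / \<beta>)) * (\<beta> * lam powr (1 / \<beta>) * exp (- lam * x powr \<beta>)))
      has_integral 1 / (2 * Gamma (1 / \<beta>)) * Gamma (1 / \<beta>)) {0<..}"
    by (intro has_integral_mult_right has_integral_exp_minus_powr) (use \<beta> lam in auto)
  then have half: "(p has_integral 1 / 2) {0<..}"
    using G by (elim has_integral_eq[rotated, THEN has_integral_eq_rhs]) (auto simp: gg_density_def)
  have si: "set_integrable lborel A p" if "A \<in> sets borel" for A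
    using int that unfolding set_integrable_def by (intro integrable_mult_indicator) auto
  have pos: "(LBINT x:{0<..}. p x) = 1 / 2"
    using set_borel_integral_eq_integral(2)[OF si, of "{0<..}"] integral_unique[OF half] by simp
  have neg: "(LBINT x:{..<0}. p x) = 1 / 2"
    unfolding set_lebesgue_integral_def
    by (subst lborel_integral_real_affine[where c = "-1" and t = 0])
       (use pos in \<open>auto simp: set_lebesgue_integral_def gg_density_minus indicator_def\<close>)
  have "integral\<^sup>L lborel p = (LBINT x:{..<0} \<union> {0<..}. p x)"
    unfolding set_lebesgue_integral_def
  proof (rule integral_cong_AE)
    show "AE x in lborel. p x = indicator ({..<0} \<union> {0<..}) x *\<^sub>R p x"
      using AE_lborel_singleton[of 0] by eventually_elim (auto simp: indicator_def)
  qed (use borel_measurable_gg_density in auto)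
  also have "\<dots> = (LBINT x:{..<0}. p x) + (LBINT x:{0<..}. p x)"
    by (rule set_integral_Un) (auto intro: si)
  finally show ?thesis
    using pos neg by simp
qed

text \<open>Reflection turns the lower tail into the integral over \<open>{x..}\<close>, which
  overlaps \<open>{..x}\<close> only in a null set; the total mass is one.\<close>

lemma gg_cdf_minus: "F (- x) = 1 - F x"
proof -
  have si: "set_integrable lborel A p" if "A \<in> sets borel" for A
    using integrable_gg_density[OF \<beta> lam] that
    unfolding set_integrable_def by (intro integrable_mult_indicator) auto
  have "F (- x) = (LBINT t:{x..}. p t)"
    unfolding gg_cdf_def set_lebesgue_integral_def
    by (subst lborel_integral_real_affine[where c = "-1" and t = 0])
       (auto simp: gg_density_minus indicator_def)
  moreover have "integral\<^sup>L lborel p = (LBINT t:{..x} \<union> {x..}. p t)"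
  proof -
    have "{..x} \<union> {x..} = (UNIV :: real set)" by auto
    then show ?thesis by (simp add: set_lebesgue_integral_def)
  qed
  moreover have "\<dots> = (LBINT t:{..x}. p t) + (LBINT t:{x..}. p t)"
  proof (rule set_integral_Un_AE)
    show "AE t in lborel. \<not> (t \<in> {..x} \<and> t \<in> {x..})"
      using AE_lborel_singleton[of x] by eventually_elim auto
  qed (auto intro: si)
  ultimately show ?thesis
    using gg_density_total by (simp add: gg_cdf_def)
qed

lemma gg_cdf_0: "F 0 = 1 / 2"
  using gg_cdf_minus[of 0] by simp

lemma gg_cdf_tendsto_1: "(F \<longlongrightarrow> 1) at_top"
proof -
  have "((\<lambda>y. \<integral>x. indicator {..y} x *\<^sub>R p x \<partial>lborel) \<longlongrightarrow> integral\<^sup>L lborel p) at_top"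
    by (rule tendsto_integral_at_top) (use integrable_gg_density[OF \<beta> lam] in auto)
  then show ?thesis
    unfolding gg_density_total gg_cdf_def[abs_def] set_lebesgue_integral_def .
qed

lemma strict_mono_gg_cdf: "strict_mono F"
  by (rule strict_monoI, rule DERIV_pos_imp_increasing)
     (use gg_cdf_has_real_derivative[OF \<beta> lam] gg_density_pos[OF \<beta> lam] in blast)+

lemma gg_cdf_mono: "x \<le> y \<Longrightarrow> F x \<le> F y"
  using strict_mono_gg_cdf by (simp add: strict_mono_less_eq)

lemma gg_cdf_less_1: "F x < 1"
proof -
  have "F (x + 1) \<le> 1"
    by (rule tendsto_lowerbound[OF gg_cdf_tendsto_1])
       (auto intro: eventually_mono[OF eventually_ge_at_top[of "x + 1"]] gg_cdf_mono)
  moreover have "F x < F (x + 1)"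
    using strict_mono_gg_cdf by (simp add: strict_mono_less)
  ultimately show ?thesis by simp
qed

lemma gg_cdf_pos: "0 < F x"
  using gg_cdf_less_1[of "- x"] gg_cdf_minus[of x] by simp

section \<open>Mills bounds for the tail\<close>

lemma gg_density_tendsto_0: "(p \<longlongrightarrow> 0) at_top"
proof -
  have "((\<lambda>x. exp (- lam * \<bar>x\<bar> powr \<beta>)) \<longlongrightarrow> 0) at_top"
    using \<beta> lam by real_asymp
  from tendsto_mult_right_zero[OF this] show ?thesis
    unfolding gg_density_def .
qed

lemma gg_score_pos: "0 < x \<Longrightarrow> 0 < \<psi> x"
  using \<beta> lam by (simp add: gg_score_def)

lemma gg_score_nonneg: "0 \<le> x \<Longrightarrow> 0 \<le> \<psi> x"
  using gg_score_pos[of x] by (cases "x = 0") auto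

lemma gg_score_at_top: "filterlim \<psi> at_top at_top"
proof -
  have "filterlim (\<lambda>x. \<beta> * lam * sgn x * \<bar>x\<bar> powr (\<beta> - 1)) at_top at_top"
    using \<beta> lam by real_asymp
  then show ?thesis unfolding gg_score_def .
qed

lemma gg_score_has_real_derivative:
  assumes "0 < x"
  shows "(\<psi> has_real_derivative \<beta> * lam * (\<beta> - 1) * x powr (\<beta> - 2)) (at x)"
proof (rule has_field_derivative_transform_within_open[where S = "{0<..}"])
  show "((\<lambda>x. \<beta> * lam * x powr (\<beta> - 1)) has_real_derivative
      \<beta> * lam * (\<beta> - 1) * x powr (\<beta> - 2)) (at x)"
    using assms by (auto intro!: derivative_eq_intros)
qed (use assms in \<open>auto simp: gg_score_def\<close>)

text \<open>By the quotient rule the derivative is \<open>- p\<close> times one plus the quotient of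
  the derivative of \<open>\<psi>\<close> by the square of \<open>\<psi>\<close>, and that quotient
  is the power term. It is positive, which drives the upper bound, and tends to \<open>0\<close>,
  which drives the lower one.\<close>

lemma gg_mills_ratio_has_real_derivative:
  assumes "0 < x"
  shows "((\<lambda>x. p x / \<psi> x) has_real_derivative
           - p x * (1 + (\<beta> - 1) / (\<beta> * lam) * x powr (- \<beta>))) (at x)"
proof -
  have "x powr (\<beta> - 2) = x powr (\<beta> - 1) * x powr (\<beta> - 1) * x powr (- \<beta>)"
    by (simp add: powr_add[symmetric])
  then have *: "\<beta> * lam * (\<beta> - 1) * x powr (\<beta> - 2) = \<psi> x * \<psi> x * ((\<beta> - 1) / (\<beta> * lam) * x powr (- \<beta>))"
    using \<beta> lam assms by (simp add: gg_score_def)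
  have "((\<lambda>x. p x / \<psi> x) has_real_derivative
      (- \<psi> x * p x * \<psi> x - p x * (\<beta> * lam * (\<beta> - 1) * x powr (\<beta> - 2))) / (\<psi> x * \<psi> x)) (at x)"
    using gg_density_has_real_derivative[OF \<beta>] gg_score_pos[OF assms]
    by (intro DERIV_divide gg_score_has_real_derivative assms) (auto simp: gg_score_def[of _ _ x])
  then show ?thesis
    unfolding * by (rule DERIV_cong) (use gg_score_pos[OF assms] in \<open>simp add: field_simps\<close>)
qed

lemma gg_mills_tendsto_0: "((\<lambda>x. c * (p x / \<psi> x) - (1 - F x)) \<longlongrightarrow> 0) at_top"
proof -
  have "((\<lambda>x. p x / \<psi> x) \<longlongrightarrow> 0) at_top"
    by (rule real_tendsto_divide_at_top[OF gg_density_tendsto_0 gg_score_at_top])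
  then have "((\<lambda>x. c * (p x / \<psi> x) - (1 - F x)) \<longlongrightarrow> c * 0 - (1 - 1)) at_top"
    by (intro tendsto_intros gg_cdf_tendsto_1)
  then show ?thesis by simp
qed

text \<open>For positive arguments the difference \<open>p / \<psi> - (1 - F)\<close> has derivative
  \<open>- p\<close> times the positive correction term, and it tends to \<open>0\<close> at
  infinity.\<close>

lemma gg_mills_upper:
  assumes "0 \<le> x"
  shows "\<psi> x * (1 - F x) \<le> p x"
proof (cases "x = 0")
  case False
  then have x: "0 < x" using assms by simp
  have "0 \<le> 1 * (p x / \<psi> x) - (1 - F x)"
  proof (rule nonneg_if_deriv_nonpos_tendsto_0[OF _ _ gg_mills_tendsto_0])
    fix y assume "x \<le> y"
    then have y: "0 < y" using x by simp
    show "((\<lambda>x. 1 * (p x / \<psi> x) - (1 - F x)) has_real_derivative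
        - p y * ((\<beta> - 1) / (\<beta> * lam) * y powr (- \<beta>))) (at y)"
      by (rule DERIV_cong, rule DERIV_diff[OF DERIV_cmult[OF gg_mills_ratio_has_real_derivative[OF y]]
            DERIV_diff[OF DERIV_const gg_cdf_has_real_derivative[OF \<beta> lam]]])
         (simp add: algebra_simps)
    show "- p y * ((\<beta> - 1) / (\<beta> * lam) * y powr (- \<beta>)) \<le> 0"
      using gg_density_pos[OF \<beta> lam, of y] \<beta> lam by (auto intro!: mult_nonpos_nonneg)
  qed
  then show ?thesis
    using gg_score_pos[OF x] by (simp add: field_simps)
qed (use gg_density_pos[OF \<beta> lam, of 0] in simp)

text \<open>For \<open>c \<le> 0\<close> the signs suffice. Otherwise \<open>c < 1\<close> absorbs
  the correction term once \<open>x\<close> is large, and from there on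
  \<open>(1 - F) - c * (p / \<psi>)\<close> decreases to \<open>0\<close>.\<close>

lemma gg_mills_lower:
  assumes "c < 1"
  shows "\<forall>\<^sub>F x in at_top. c * p x \<le> \<psi> x * (1 - F x)"
proof (cases "c \<le> 0")
  case True
  show ?thesis
    using eventually_ge_at_top[of 0]
  proof eventually_elim
    case (elim x)
    have "c * p x \<le> 0"
      using True gg_density_pos[OF \<beta> lam, of x] by (simp add: mult_nonpos_nonneg)
    also have "0 \<le> \<psi> x * (1 - F x)"
      using gg_score_nonneg[OF elim] gg_cdf_less_1[of x] by simp
    finally show ?case .
  qed
next
  case False
  have "((\<lambda>x. c * (1 + (\<beta> - 1) / (\<beta> * lam) * x powr (- \<beta>))) \<longlongrightarrow> c * (1 + (\<beta> - 1) / (\<beta> * lam) * 0)) at_top"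
    by (intro tendsto_intros tendsto_neg_powr) (use \<beta> in \<open>auto intro: filterlim_ident\<close>)
  then have "\<forall>\<^sub>F x in at_top. c * (1 + (\<beta> - 1) / (\<beta> * lam) * x powr (- \<beta>)) < 1"
    by (rule order_tendstoD) (use assms in simp)
  then obtain X where X: "c * (1 + (\<beta> - 1) / (\<beta> * lam) * x powr (- \<beta>)) < 1" if "X \<le> x" for x
    by (auto simp: eventually_at_top_linorder)
  show ?thesis
    using eventually_ge_at_top[of X] eventually_gt_at_top[of 0]
  proof eventually_elim
    case (elim x)
    have "0 \<le> (1 - F x) - c * (p x / \<psi> x)"
    proof (rule nonneg_if_deriv_nonpos_tendsto_0[where g = "\<lambda>x. (1 - F x) - c * (p x / \<psi> x)"])
      fix y assume "x \<le> y"
      then have y: "0 < y" "X \<le> y" using elim by auto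
      show "((\<lambda>x. (1 - F x) - c * (p x / \<psi> x)) has_real_derivative
          - p y * (1 - c * (1 + (\<beta> - 1) / (\<beta> * lam) * y powr (- \<beta>)))) (at y)"
        by (rule DERIV_cong, rule DERIV_diff[OF DERIV_diff[OF DERIV_const gg_cdf_has_real_derivative[OF \<beta> lam]]
              DERIV_cmult[OF gg_mills_ratio_has_real_derivative[OF y(1)]]])
           (simp add: algebra_simps)
      show "- p y * (1 - c * (1 + (\<beta> - 1) / (\<beta> * lam) * y powr (- \<beta>))) \<le> 0"
        using gg_density_pos[OF \<beta> lam, of y] X[OF y(2)] by (intro mult_nonpos_nonneg) auto
    next
      show "((\<lambda>x. (1 - F x) - c * (p x / \<psi> x)) \<longlongrightarrow> 0) at_top"
        using tendsto_minus[OF gg_mills_tendsto_0[of c]] by simp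
    qed
    then show ?case
      using gg_score_pos[OF elim(2)] by (simp add: field_simps)
  qed
qed

section \<open>Pointwise bounds for the solution and its derivative\<close>

lemma abs_gg_score_mult_cdf_le:
  assumes "x \<le> 0"
  shows "\<bar>\<psi> x\<bar> * F x \<le> p x"
  using gg_mills_upper[of "- x"] gg_score_nonneg[of "- x"] assms
  by (simp add: gg_score_minus gg_cdf_minus gg_density_minus)

text \<open>Reflection swaps the two branches, which agree at \<open>x = z\<close>. The bounds below
  therefore need a proof only for \<open>x \<le> z\<close>.\<close>

lemma stein_sol_minus: "stein_sol \<beta> lam (- z) (- x) = stein_sol \<beta> lam z x"
  by (auto simp: stein_sol_def gg_cdf_minus gg_density_minus)

lemma stein_sol_nonneg: "0 \<le> stein_sol \<beta> lam z x"
  using gg_cdf_pos gg_cdf_less_1 gg_density_pos[OF \<beta> lam]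
  by (auto simp: stein_sol_def less_imp_le)

lemma stein_sol_eq_left: "x \<le> z \<Longrightarrow> stein_sol \<beta> lam z x = F x * (1 - F z) / p x"
  by (simp add: stein_sol_def)

text \<open>Let \<open>x \<le> z\<close>. If \<open>x \<le> 0\<close>, the reflected Mills bound
  controls \<open>\<bar>\<psi> x\<bar> * F x\<close>. If \<open>x > 0\<close>, then
  \<open>1 - F z \<le> 1 - F x\<close> reduces the claim to the Mills bound itself.\<close>

lemma abs_score_mult_stein_sol_le_1: "\<bar>\<psi> x * stein_sol \<beta> lam z x\<bar> \<le> 1"
proof -
  have *: "\<bar>\<psi> x * stein_sol \<beta> lam z x\<bar> \<le> 1" if "x \<le> z" for x z
  proof -
    have p: "0 < p x"
      by (rule gg_density_pos[OF \<beta> lam])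
    have F: "0 < F x" "F x < 1" "0 < F z" "F z < 1" "F x \<le> F z"
      using gg_cdf_pos gg_cdf_less_1 gg_cdf_mono[OF that] by auto
    have eq: "\<bar>\<psi> x * stein_sol \<beta> lam z x\<bar> = \<bar>\<psi> x\<bar> * F x * (1 - F z) / p x"
      using that p F by (simp add: stein_sol_eq_left abs_mult)
    have "\<bar>\<psi> x\<bar> * F x * (1 - F z) \<le> p x"
    proof (cases "x \<le> 0")
      case True
      have "\<bar>\<psi> x\<bar> * F x * (1 - F z) \<le> p x * 1"
        by (rule mult_mono[OF abs_gg_score_mult_cdf_le[OF True]]) (use F p in auto)
      then show ?thesis by simp
    next
      case False
      have "\<bar>\<psi> x\<bar> * F x * (1 - F z) \<le> \<bar>\<psi> x\<bar> * 1 * (1 - F x)"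
        by (intro mult_mono) (use F in auto)
      also have "\<dots> \<le> p x"
        using gg_mills_upper[of x] gg_score_nonneg[of x] False by simp
      finally show ?thesis .
    qed
    then show ?thesis
      unfolding eq using p by simp
  qed
  show ?thesis
    using *[of x z] *[of "- x" "- z"] by (cases "x \<le> z") (auto simp: stein_sol_minus gg_score_minus)
qed

text \<open>For \<open>x \<le> z\<close> the expression factors as
  \<open>(1 - F z) * (1 + \<psi> x * F x / p x)\<close>. If \<open>x \<le> 0\<close>, both factors
  lie between \<open>0\<close> and \<open>1\<close>. If \<open>x > 0\<close>, replacing
  \<open>F z\<close> by \<open>F x\<close> gives a convex combination of \<open>1\<close> and the
  ratio \<open>\<psi> x * (1 - F x) / p x\<close>, which is at most \<open>1\<close>.\<close>

lemma abs_stein_sol_deriv_le_1: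
  "\<bar>\<psi> x * stein_sol \<beta> lam z x + (indicator {..z} x - F z)\<bar> \<le> 1"
proof -
  have *: "\<bar>\<psi> x * stein_sol \<beta> lam z x + (1 - F z)\<bar> \<le> 1" if "x \<le> z" for x z
  proof -
    have p: "0 < p x"
      by (rule gg_density_pos[OF \<beta> lam])
    have F: "0 < F x" "F x < 1" "0 < F z" "F z < 1" "F x \<le> F z"
      using gg_cdf_pos gg_cdf_less_1 gg_cdf_mono[OF that] by auto
    have eq: "\<psi> x * stein_sol \<beta> lam z x + (1 - F z) = (1 - F z) * (1 + \<psi> x * F x / p x)"
      using that p by (simp add: stein_sol_eq_left field_simps)
    have "0 \<le> 1 + \<psi> x * F x / p x \<and> (1 - F z) * (1 + \<psi> x * F x / p x) \<le> 1"
    proof (cases "x \<le> 0")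
      case True
      have "\<bar>\<psi> x\<bar> = - \<psi> x"
        using gg_score_nonneg[of "- x"] True by (simp add: gg_score_minus)
      then have "- (\<psi> x * F x) \<le> p x" "\<psi> x * F x \<le> 0"
        using abs_gg_score_mult_cdf_le[OF True] F by (auto intro: mult_nonpos_nonneg)
      then have "0 \<le> 1 + \<psi> x * F x / p x" "1 + \<psi> x * F x / p x \<le> 1"
        using p by (auto simp: field_simps)
      moreover from this have "(1 - F z) * (1 + \<psi> x * F x / p x) \<le> 1 * 1"
        by (intro mult_mono) (use F in auto)
      ultimately show ?thesis by simp
    next
      case False
      then have \<psi>: "0 \<le> \<psi> x" and le: "\<psi> x * (1 - F x) / p x \<le> 1"
        using gg_score_nonneg[of x] gg_mills_upper[of x] p by auto
      have nonneg: "0 \<le> 1 + \<psi> x * F x / p x"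
        using \<psi> F p by simp
      have "(1 - F z) * (1 + \<psi> x * F x / p x) \<le> (1 - F x) * (1 + \<psi> x * F x / p x)"
        by (rule mult_right_mono) (use F nonneg in auto)
      also have "\<dots> = (1 - F x) + F x * (\<psi> x * (1 - F x) / p x)"
        using p by (simp add: field_simps)
      also have "\<dots> \<le> (1 - F x) + F x * 1"
        using le F by (intro add_left_mono mult_left_mono) auto
      finally show ?thesis using nonneg by simp
    qed
    then show ?thesis
      unfolding eq using F by (simp add: abs_mult)
  qed
  show ?thesis
  proof (cases "x \<le> z")
    case True
    then show ?thesis using *[of x z] by simp
  next
    case False
    \<comment> \<open>Reflection turns \<open>\<psi> x * stein_sol \<beta> lam z x - F z\<close>
      into its negative, which the absolute value ignores.\<close>
    then show ?thesis
      using *[of "- x" "- z"] by (simp add: stein_sol_minus gg_score_minus gg_cdf_minus)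
  qed
qed

section \<open>Sharpness of the bounds for the score term and the derivative\<close>

lemma gg_mills_ratio_tendsto_1: "((\<lambda>x. \<psi> x * (1 - F x) / p x) \<longlongrightarrow> 1) at_top"
proof (rule order_tendstoI)
  fix c :: real assume "c < 1"
  then obtain d where d: "c < d" "d < 1"
    using dense by blast
  show "\<forall>\<^sub>F x in at_top. c < \<psi> x * (1 - F x) / p x"
    using gg_mills_lower[OF d(2)]
  proof eventually_elim
    case (elim x)
    have "d \<le> \<psi> x * (1 - F x) / p x"
      using elim gg_density_pos[OF \<beta> lam, of x] by (simp add: field_simps)
    then show ?case using d by simp
  qed
next
  fix c :: real assume c: "1 < c"
  show "\<forall>\<^sub>F x in at_top. \<psi> x * (1 - F x) / p x < c"
    using eventually_ge_at_top[of 0]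
  proof eventually_elim
    case (elim x)
    have "\<psi> x * (1 - F x) / p x \<le> 1"
      using gg_mills_upper[OF elim] gg_density_pos[OF \<beta> lam, of x] by simp
    then show ?case using c by simp
  qed
qed

text \<open>On the diagonal the score term is \<open>F z\<close> times the ratio
  \<open>\<psi> z * (1 - F z) / p z\<close>, and both factors tend to \<open>1\<close>.\<close>

lemma score_mult_stein_sol_diag_tendsto_1: "((\<lambda>z. \<psi> z * stein_sol \<beta> lam z z) \<longlongrightarrow> 1) at_top"
  using tendsto_mult[OF gg_cdf_tendsto_1 gg_mills_ratio_tendsto_1]
  by (simp add: stein_sol_eq_left mult_ac)

lemma SUP_score_mult_stein_sol:
  "(SUP z. SUP x. ereal \<bar>\<psi> x * stein_sol \<beta> lam z x\<bar>) = 1" (is "?S = 1")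
proof (rule antisym)
  show "?S \<le> 1"
    using abs_score_mult_stein_sol_le_1 by (intro SUP_least) (simp add: one_ereal_def)
  have lim: "((\<lambda>z. ereal \<bar>\<psi> z * stein_sol \<beta> lam z z\<bar>) \<longlongrightarrow> ereal \<bar>1\<bar>) at_top"
    by (intro tendsto_intros score_mult_stein_sol_diag_tendsto_1)
  have "ereal \<bar>\<psi> z * stein_sol \<beta> lam z z\<bar> \<le> ?S" for z
    by (rule SUP_upper2[of z], simp, rule SUP_upper) simp
  then have "ereal \<bar>1\<bar> \<le> ?S"
    by (intro tendsto_upperbound[OF lim] always_eventually allI) simp_all
  then show "1 \<le> ?S"
    by (simp add: one_ereal_def)
qed

lemma deriv_stein_sol:
  "x \<noteq> z \<Longrightarrow> deriv (stein_sol \<beta> lam z) x = \<psi> x * stein_sol \<beta> lam z x + (indicator {..z} x - F z)"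
  using stein_sol_has_real_derivative[OF \<beta> lam] by (simp add: DERIV_imp_deriv gg_score_def)

lemma borel_measurable_gg_cdf [measurable]: "F \<in> borel_measurable borel"
  using gg_cdf_has_real_derivative[OF \<beta> lam]
  by (intro borel_measurable_continuous_onI) (meson DERIV_isCont continuous_at_imp_continuous_on)

lemma borel_measurable_gg_score [measurable]: "\<psi> \<in> borel_measurable borel"
  unfolding gg_score_def by measurable

lemma borel_measurable_stein_sol [measurable]: "stein_sol \<beta> lam z \<in> borel_measurable borel"
  unfolding stein_sol_def by measurable

text \<open>The bound on the essential supremum requires measurability. The value of
  \<open>deriv\<close> at \<open>z\<close> is carried along as an unknown constant at a single
  point.\<close>

lemma borel_measurable_deriv_stein_sol [measurable]:
  "deriv (stein_sol \<beta> lam z) \<in> borel_measurable borel"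
proof -
  have "deriv (stein_sol \<beta> lam z) = (\<lambda>x. if x = z then deriv (stein_sol \<beta> lam z) z
      else \<psi> x * stein_sol \<beta> lam z x + (indicator {..z} x - F z))"
    by (auto simp: deriv_stein_sol)
  also have "\<dots> \<in> borel_measurable borel"
    by measurable
  finally show ?thesis .
qed

text \<open>The left branch is used because its jump term \<open>1 - F z\<close> is positive, so the
  limit exceeds the score term on the diagonal.\<close>

lemma deriv_stein_sol_tendsto_left:
  assumes "0 < z"
  shows "(deriv (stein_sol \<beta> lam z) \<longlongrightarrow> \<psi> z * stein_sol \<beta> lam z z + (1 - F z)) (at_left z)"
proof -
  have "(p \<longlongrightarrow> p z) (at_left z)" "(F \<longlongrightarrow> F z) (at_left z)" "(\<psi> \<longlongrightarrow> \<psi> z) (at_left z)"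
    using gg_density_has_real_derivative[OF \<beta>] gg_cdf_has_real_derivative[OF \<beta> lam]
      gg_score_has_real_derivative[OF assms]
    by (meson DERIV_isCont continuous_at_imp_continuous_at_within continuous_within)+
  then have "((\<lambda>x. \<psi> x * (F x * (1 - F z) / p x) + (1 - F z)) \<longlongrightarrow>
      \<psi> z * (F z * (1 - F z) / p z) + (1 - F z)) (at_left z)"
    using gg_density_pos[OF \<beta> lam, of z] by (intro tendsto_intros) auto
  moreover have "\<forall>\<^sub>F x in at_left z. \<psi> x * (F x * (1 - F z) / p x) + (1 - F z)
      = deriv (stein_sol \<beta> lam z) x"
    by (auto simp: eventually_at_filter deriv_stein_sol stein_sol_eq_left)
  ultimately show ?thesis
    by (simp add: stein_sol_eq_left tendsto_cong)
qed

lemma ess_sup_norm_deriv_stein_sol_le_1: "ess_sup_norm (deriv (stein_sol \<beta> lam z)) \<le> 1"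
  unfolding ess_sup_norm_def
proof (rule esssup_I)
  show "AE x in lborel. ereal \<bar>deriv (stein_sol \<beta> lam z) x\<bar> \<le> 1"
    using AE_lborel_singleton[of z]
    by eventually_elim (use abs_stein_sol_deriv_le_1 in \<open>simp add: deriv_stein_sol one_ereal_def\<close>)
qed measurable

lemma SUP_ess_sup_norm_deriv_stein_sol:
  "(SUP z. ess_sup_norm (deriv (stein_sol \<beta> lam z))) = 1" (is "?S = 1")
proof (rule antisym)
  show "?S \<le> 1"
    by (intro SUP_least ess_sup_norm_deriv_stein_sol_le_1)
  have "((\<lambda>z. ereal (\<psi> z * stein_sol \<beta> lam z z)) \<longlongrightarrow> ereal 1) at_top"
    by (intro tendsto_intros score_mult_stein_sol_diag_tendsto_1)
  moreover have "\<forall>\<^sub>F z in at_top. ereal (\<psi> z * stein_sol \<beta> lam z z) \<le> ?S"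
    using eventually_gt_at_top[of 0]
  proof eventually_elim
    case (elim z)
    have "ereal (\<psi> z * stein_sol \<beta> lam z z) \<le> ereal \<bar>\<psi> z * stein_sol \<beta> lam z z + (1 - F z)\<bar>"
      using gg_cdf_less_1[of z] by simp
    also have "\<dots> \<le> ess_sup_norm (deriv (stein_sol \<beta> lam z))"
      by (rule abs_le_ess_sup_norm_at_left[OF deriv_stein_sol_tendsto_left[OF elim]])
    also have "\<dots> \<le> ?S"
      by (rule SUP_upper) simp
    finally show ?case .
  qed
  ultimately have "ereal 1 \<le> ?S"
    by (intro tendsto_upperbound) auto
  then show "1 \<le> ?S"
    by (simp add: one_ereal_def)
qed

section \<open>The supremum of the solution\<close>

text \<open>The derivative of \<open>F / p\<close> is \<open>(p + \<psi> * F) / p\<close>. It is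
  nonnegative by the reflected Mills bound on the left half-line and by signs on the right.\<close>

lemma gg_cdf_divide_density_mono:
  assumes "x \<le> y"
  shows "F x / p x \<le> F y / p y"
proof (rule DERIV_nonneg_imp_nondecreasing[OF assms])
  fix t
  have p: "0 < p t"
    by (rule gg_density_pos[OF \<beta> lam])
  have "((\<lambda>x. F x / p x) has_real_derivative (p t * p t - F t * (- \<psi> t * p t)) / (p t * p t)) (at t)"
    using gg_density_has_real_derivative[OF \<beta>] gg_cdf_has_real_derivative[OF \<beta> lam] p
    by (intro DERIV_divide) (auto simp: gg_score_def)
  moreover have "0 \<le> p t + \<psi> t * F t"
    using abs_gg_score_mult_cdf_le[of t] gg_score_nonneg[of t] gg_cdf_pos[of t] p abs_ge_minus_self[of "\<psi> t"]
      mult_right_mono[of "- \<psi> t" "\<bar>\<psi> t\<bar>" "F t"]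
    by (cases "t \<le> 0") auto
  then have "0 \<le> p t * (p t + \<psi> t * F t) / (p t * p t)"
    using p by simp
  then have "0 \<le> (p t * p t - F t * (- \<psi> t * p t)) / (p t * p t)"
    by (simp add: algebra_simps)
  ultimately show "\<exists>D. ((\<lambda>x. F x / p x) has_real_derivative D) (at t) \<and> 0 \<le> D"
    by blast
qed

lemma stein_sol_le_diag: "stein_sol \<beta> lam z x \<le> stein_sol \<beta> lam z z"
proof -
  have *: "stein_sol \<beta> lam z x \<le> stein_sol \<beta> lam z z" if "x \<le> z" for x z
    using mult_right_mono[OF gg_cdf_divide_density_mono[OF that], of "1 - F z"] gg_cdf_less_1[of z] that
    by (simp add: stein_sol_eq_left)
  show ?thesis
    using *[of x z] *[of "- x" "- z"] by (cases "x \<le> z") (auto simp: stein_sol_minus)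
qed

lemma gg_density_antimono: "0 \<le> x \<Longrightarrow> x \<le> y \<Longrightarrow> p y \<le> p x"
  unfolding gg_density_def using \<beta> lam Gamma_real_pos[of "1 / \<beta>"]
  by (intro mult_left_mono) (simp_all add: powr_mono2)

text \<open>The mean value theorem will be applied on an interval starting at \<open>0\<close>,
  whereas the derivative of \<open>\<psi>\<close> is established only for positive
  arguments.\<close>

lemma continuous_on_gg_score_nonneg: "continuous_on {0..} \<psi>"
proof (rule continuous_on_eq)
  show "continuous_on {0..} (\<lambda>x. \<beta> * lam * x powr (\<beta> - 1))"
    using \<beta> by (auto intro!: continuous_intros continuous_on_powr')
qed (auto simp: gg_score_def sgn_if)

text \<open>With \<open>E = 4 p(0) (2 F - 1) - \<psi>\<close> one has \<open>(p - 4 p(0) F (1 - F))' = p E\<close>. For \<open>\<beta> \<ge> 2\<close> the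
  function \<open>E\<close> is concave on \<open>[0, \<infinity>)\<close> with \<open>E(0) = 0\<close>, so it changes sign at most once, from
  positive to negative; hence the minimum of \<open>p - 4 p(0) F (1 - F)\<close> is its value \<open>0\<close> at the
  endpoints \<open>0\<close> and \<open>\<infinity>\<close>.\<close>

lemma gg_sign_change:
  assumes "2 \<le> \<beta>" "0 < y" "y \<le> z"
    and z: "0 \<le> 4 * p 0 * (2 * F z - 1) - \<psi> z"
  shows "0 \<le> 4 * p 0 * (2 * F y - 1) - \<psi> y"
proof (rule ccontr)
  let ?E = "\<lambda>x. 4 * p 0 * (2 * F x - 1) - \<psi> x"
  let ?E' = "\<lambda>x. 8 * p 0 * p x - \<beta> * lam * (\<beta> - 1) * x powr (\<beta> - 2)"
  assume neg: "\<not> 0 \<le> ?E y"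
  with z \<open>y \<le> z\<close> have yz: "y < z"
    by (cases "y = z") auto
  have cont: "continuous_on {a..b} ?E" if "0 \<le> a" for a b
  proof (intro continuous_intros)
    show "continuous_on {a..b} F"
      using gg_cdf_has_real_derivative[OF \<beta> lam]
      by (meson DERIV_isCont continuous_at_imp_continuous_on)
    show "continuous_on {a..b} \<psi>"
      by (rule continuous_on_subset[OF continuous_on_gg_score_nonneg]) (use that in auto)
  qed
  have der: "(?E has_derivative (*) (?E' x)) (at x)" if "0 < x" for x
    unfolding has_field_derivative_def[symmetric]
    using gg_cdf_has_real_derivative[OF \<beta> lam, of x] gg_score_has_real_derivative[OF that]
    by (auto intro!: derivative_eq_intros)
  \<comment> \<open>If \<open>?E\<close> is negative at \<open>y\<close>, its mean slope is negative
    on \<open>[0, y]\<close> and positive on \<open>[y, z]\<close>, although \<open>?E'\<close> is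
    nonincreasing: \<open>p\<close> decreases and, by \<open>2 \<le> \<beta>\<close>,
    \<open>x powr (\<beta> - 2)\<close> does not decrease.\<close>
  obtain a where a: "0 < a" "a < y" "?E y - ?E 0 = ?E' a * (y - 0)"
    by (rule mvt[OF \<open>0 < y\<close> cont[OF order_refl] der]) auto
  obtain b where b: "y < b" "b < z" "?E z - ?E y = ?E' b * (z - y)"
    by (rule mvt[OF yz cont der]) (use \<open>0 < y\<close> in auto)
  have "?E' b \<le> ?E' a"
    using a b \<beta> lam assms(1) gg_density_pos[OF \<beta> lam, of 0]
    by (intro diff_mono mult_left_mono gg_density_antimono powr_mono2) auto
  moreover have "?E 0 = 0"
    by (simp add: gg_cdf_0)
  then have "?E' a * (y - 0) < 0"
    using a(3) neg by linarith
  then have "?E' a < 0"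
    using \<open>0 < y\<close> by (simp add: mult_less_0_iff)
  moreover have "0 < ?E' b * (z - y)"
    using b(3) z neg by linarith
  then have "0 < ?E' b"
    using yz by (simp add: zero_less_mult_iff)
  ultimately show False by linarith
qed

lemma gg_cdf_mult_tail_le:
  assumes "2 \<le> \<beta>"
  shows "4 * p 0 * (F z * (1 - F z)) \<le> p z"
proof -
  have *: "4 * p 0 * (F z * (1 - F z)) \<le> p z" if z: "0 < z" for z
  proof -
    let ?D = "\<lambda>x. p x - 4 * p 0 * (F x * (1 - F x))"
    let ?E = "\<lambda>x. 4 * p 0 * (2 * F x - 1) - \<psi> x"
    have der: "(?D has_real_derivative p x * ?E x) (at x)" for x
      using gg_cdf_has_real_derivative[OF \<beta> lam, of x] gg_density_has_real_derivative[OF \<beta>, of lam x]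
      by (auto intro!: derivative_eq_intros simp: gg_score_def algebra_simps)
    have p: "0 < p x" for x
      by (rule gg_density_pos[OF \<beta> lam])
    have "0 \<le> ?D z"
    \<comment> \<open>If \<open>?E z \<ge> 0\<close>, then \<open>?E\<close> is nonnegative on all
      of \<open>[0, z]\<close> and \<open>?D\<close> grows from \<open>?D 0 = 0\<close>. Otherwise
      \<open>?E\<close> stays nonpositive beyond \<open>z\<close> and \<open>?D\<close> descends to
      its limit \<open>0\<close>.\<close>
    proof (cases "0 \<le> ?E z")
      case True
      have "?D 0 \<le> ?D z"
      proof (rule DERIV_nonneg_imp_nondecreasing[where f = ?D])
        fix x assume x: "0 \<le> x" "x \<le> z"
        have "0 \<le> ?E x"
          using gg_sign_change[OF assms _ x(2) True] x(1) by (cases "x = 0") (auto simp: gg_cdf_0)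
        then have "0 \<le> p x * ?E x"
          using p[of x] by simp
        then show "\<exists>D. (?D has_real_derivative D) (at x) \<and> 0 \<le> D"
          using der by blast
      qed (use z in simp)
      then show ?thesis by (simp add: gg_cdf_0)
    next
      case False
      show ?thesis
      proof (rule nonneg_if_deriv_nonpos_tendsto_0[where g = ?D and g' = \<open>\<lambda>x. p x * ?E x\<close>, OF der])
        fix x assume "z \<le> x"
        then have "?E x \<le> 0"
          using gg_sign_change[OF assms z, of x] False by linarith
        then show "p x * ?E x \<le> 0"
          using p[of x] by (simp add: mult_nonneg_nonpos)
      next
        have "(?D \<longlongrightarrow> 0 - 4 * p 0 * (1 * (1 - 1))) at_top"
          by (intro tendsto_intros gg_cdf_tendsto_1 gg_density_tendsto_0)
        then show "(?D \<longlongrightarrow> 0) at_top" by simp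
      qed
    qed
    then show ?thesis by simp
  qed
  consider "z = 0" | "0 < z" | "0 < - z" by linarith
  then show ?thesis
  proof cases
    case 3
    then show ?thesis
      using *[of "- z"] by (simp add: gg_cdf_minus gg_density_minus mult_ac)
  qed (use * in \<open>auto simp: gg_cdf_0\<close>)
qed

lemma SUP_sup_norm_stein_sol:
  assumes "2 \<le> \<beta>"
  shows "(SUP z. sup_norm (stein_sol \<beta> lam z)) = ereal (1 / (4 * p 0))" (is "?S = _")
proof (rule antisym)
  have "\<bar>stein_sol \<beta> lam z x\<bar> \<le> 1 / (4 * p 0)" for z x
  proof -
    have "stein_sol \<beta> lam z z \<le> 1 / (4 * p 0)"
      using gg_cdf_mult_tail_le[OF assms, of z] gg_density_pos[OF \<beta> lam, of z]
        gg_density_pos[OF \<beta> lam, of 0]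
      by (simp add: stein_sol_eq_left field_simps)
    then show ?thesis
      using stein_sol_le_diag[of z x] stein_sol_nonneg[of z x] by simp
  qed
  then show "?S \<le> ereal (1 / (4 * p 0))"
    unfolding sup_norm_def by (intro SUP_least) simp
  \<comment> \<open>The bound is attained at \<open>x = z = 0\<close>, where
    \<open>F 0 = 1 / 2\<close>.\<close>
  have "ereal (1 / (4 * p 0)) = ereal \<bar>stein_sol \<beta> lam 0 0\<bar>"
    using gg_density_pos[OF \<beta> lam, of 0] by (simp add: stein_sol_eq_left gg_cdf_0)
  also have "\<dots> \<le> ?S"
    unfolding sup_norm_def by (rule SUP_upper2[of 0], simp, rule SUP_upper) simp
  finally show "ereal (1 / (4 * p 0)) \<le> ?S" .
qed

end

theorem mainTheorem4:
  fixes \<beta> lam :: real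
  assumes "\<beta> \<ge> 2" and "lam > 0"
  shows "(SUP z. sup_norm (stein_sol \<beta> lam z))
           = ereal (Gamma (1 / \<beta>) / (2 * \<beta> * lam powr (1 / \<beta>)))
       \<and> (SUP z. ess_sup_norm (deriv (stein_sol \<beta> lam z))) = 1
       \<and> (SUP z. SUP x. ereal \<bar>\<beta> * lam * sgn x * \<bar>x\<bar> powr (\<beta> - 1) * stein_sol \<beta> lam z x\<bar>) = 1"
proof (intro conjI)
  have \<beta>: "1 < \<beta>" using assms by simp
  have "1 / (4 * gg_density \<beta> lam 0) = Gamma (1 / \<beta>) / (2 * \<beta> * lam powr (1 / \<beta>))"
    by (simp add: gg_density_def)
  then show "(SUP z. sup_norm (stein_sol \<beta> lam z))
      = ereal (Gamma (1 / \<beta>) / (2 * \<beta> * lam powr (1 / \<beta>)))"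
    using SUP_sup_norm_stein_sol[OF \<beta> assms(2,1)] by simp
  show "(SUP z. ess_sup_norm (deriv (stein_sol \<beta> lam z))) = 1"
    by (rule SUP_ess_sup_norm_deriv_stein_sol[OF \<beta> assms(2)])
  show "(SUP z. SUP x. ereal \<bar>\<beta> * lam * sgn x * \<bar>x\<bar> powr (\<beta> - 1) * stein_sol \<beta> lam z x\<bar>) = 1"
    using SUP_score_mult_stein_sol[OF \<beta> assms(2)] by (simp only: gg_score_def)
qed

end
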